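(* Let $E, F$ be Banach lattices with $E^{*}$ having the positive Schur property. The adjoint $T^* \colon F^* \longrightarrow E^*$ of every regular operator $T\colon E \longrightarrow F$ is almost Dunford-Pettis.
   Context: Operators are linear. An operator between Banach lattices is regular if it is the difference of two positive operators. A Banach lattice has the positive Schur property if every weakly null sequence of positive elements in it is norm null. An operator from a Banach lattice to a Banach space is almost Dunford-Pettis if it sends disjoint weakly null sequences to norm null sequences (equivalently, positive disjoint weakly null sequences to norm null sequences). *)

theory Defs
  imports "HOL-Analysis.Analysis" "HOL-Library.Lattice_Algebras"
begin

section \<open>Banach lattices\<close>

class banach_lattice = banach + ordered_real_vector + lattice_ab_group_add_abs +
  assumes norm_le_if_abs_le: "\<bar>x\<bar> \<le> \<bar>y\<bar> \<Longrightarrow> norm x \<le> norm y"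

lemma norm_mono_nonneg:
  fixes x y :: "'a::banach_lattice"
  assumes "0 \<le> x" "x \<le> y"
  shows "norm x \<le> norm y"
  using assms by (intro norm_le_if_abs_le) (simp add: order_trans[OF assms])

lemma norm_abs_eq [simp]: "norm \<bar>x\<bar> = norm (x :: 'a::banach_lattice)"
  by (intro antisym norm_le_if_abs_le) simp_all

lemma pprt_le_abs: "pprt x \<le> \<bar>x :: 'a::banach_lattice\<bar>"
  by (simp add: abs_prts)

lemma norm_pprt_le: "norm (pprt x) \<le> norm (x :: 'a::banach_lattice)"
  using norm_mono_nonneg[OF zero_le_pprt pprt_le_abs, of x] by simp

lemma pprt_diff: "x = pprt x - pprt (- x :: 'a::banach_lattice)"
  using prts[of x] by (simp add: pprt_neg)

lemma closed_nonneg_cone: "closed {x :: 'a::banach_lattice. 0 \<le> x}"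
unfolding closed_sequential_limits
proof safe
  fix s :: "nat \<Rightarrow> 'a" and l
  assume s: "\<forall>n. s n \<in> {x. 0 \<le> x}" and lim: "s \<longlonglongrightarrow> l"
  have "norm (pprt (- l)) \<le> norm (s n - l)" for n
  proof -
    have "- l \<le> pprt (s n - l)"
      using s by (auto simp: pprt_def intro: le_supI1)
    then have "pprt (- l) \<le> pprt (s n - l)"
      by (auto simp: pprt_def[of "- l"])
    then have "norm (pprt (- l)) \<le> norm (pprt (s n - l))"
      by (intro norm_mono_nonneg) auto
    also have "\<dots> \<le> norm (s n - l)" by (rule norm_pprt_le)
    finally show ?thesis .
  qed
  moreover have "(\<lambda>n. norm (s n - l)) \<longlonglongrightarrow> 0"
    using lim by (simp add: LIM_zero_iff tendsto_norm_zero)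
  ultimately have "norm (pprt (- l)) \<le> 0"
    by (intro LIMSEQ_le_const[of "\<lambda>n. norm (s n - l)"]) auto
  then have "- l \<le> 0"
    by (simp add: le_zero_iff_zero_pprt)
  then show "0 \<le> l" by simp
qed

lemma linear_extension_from_cone:
  fixes p :: "'a::banach_lattice \<Rightarrow> real"
  assumes add: "\<And>x y. 0 \<le> x \<Longrightarrow> 0 \<le> y \<Longrightarrow> p (x + y) = p x + p y"
    and scale: "\<And>c x. 0 \<le> c \<Longrightarrow> 0 \<le> x \<Longrightarrow> p (c *\<^sub>R x) = c * p x"
  shows "linear (\<lambda>x. p (pprt x) - p (pprt (- x)))"
proof -
  let ?P = "\<lambda>x. p (pprt x) - p (pprt (- x))"
  have dec: "?P (a - b) = p a - p b" if "0 \<le> a" "0 \<le> b" for a b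
  proof -
    have "pprt (a - b) + b = a + pprt (- (a - b))"
      using pprt_diff[of "a - b"] by (simp add: algebra_simps)
    then have "p (pprt (a - b)) + p b = p a + p (pprt (- (a - b)))"
      using add that by (metis zero_le_pprt)
    then show ?thesis by simp
  qed
  show ?thesis
  proof (rule linearI)
    fix x y :: 'a
    have "x + y = (pprt x + pprt y) - (pprt (- x) + pprt (- y))"
      by (subst pprt_diff[of x], subst pprt_diff[of y]) (simp add: algebra_simps)
    then have "?P (x + y) = p (pprt x + pprt y) - p (pprt (- x) + pprt (- y))"
      using dec by (metis add_nonneg_nonneg zero_le_pprt)
    then show "?P (x + y) = ?P x + ?P y"
      by (simp add: add)
  next
    fix c :: real and x :: 'a
    show "?P (c *\<^sub>R x) = c *\<^sub>R ?P x"
    proof (cases "0 \<le> c")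
      case True
      have "c *\<^sub>R x = c *\<^sub>R pprt x - c *\<^sub>R pprt (- x)"
        by (subst pprt_diff[of x]) (simp add: scaleR_diff_right)
      then have "?P (c *\<^sub>R x) = p (c *\<^sub>R pprt x) - p (c *\<^sub>R pprt (- x))"
        using dec True by (metis scaleR_nonneg_nonneg zero_le_pprt)
      then show ?thesis
        using True by (simp add: scale algebra_simps)
    next
      case False
      have "c *\<^sub>R x = (- c) *\<^sub>R pprt (- x) - (- c) *\<^sub>R pprt x"
        by (subst pprt_diff[of x]) (simp add: scaleR_diff_right)
      then have "?P (c *\<^sub>R x) = p ((- c) *\<^sub>R pprt (- x)) - p ((- c) *\<^sub>R pprt x)"
        using dec False
        by (metis less_eq_real_def linorder_not_le neg_0_le_iff_le scaleR_nonneg_nonneg zero_le_pprt)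
      then show ?thesis
        using False scale[of "- c" "pprt (- x)"] scale[of "- c" "pprt x"]
        by (simp add: algebra_simps)
    qed
  qed
qed


section \<open>The dual Banach lattice\<close>

text \<open>The type of norm-bounded linear functionals. It is a copy of \<open>'a \<Rightarrow>\<^sub>L real\<close>; a type of its own
  is needed because \<open>blinfun\<close> cannot be made a lattice for codomain \<open>real\<close> only.\<close>

typedef (overloaded) 'a dual = "{f :: 'a::real_normed_vector \<Rightarrow> real. bounded_linear f}"
  morphisms dual_apply Dual
  by (blast intro: bounded_linear_intros)

setup_lifting type_definition_dual

lemma bounded_linear_dual_apply: "bounded_linear (dual_apply f)"
  using dual_apply by blast

lemma dual_eqI: "(\<And>x. dual_apply f x = dual_apply g x) \<Longrightarrow> f = g"
  by transfer auto

instantiation dual :: (real_normed_vector) real_normed_vector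
begin

lift_definition norm_dual :: "'a dual \<Rightarrow> real" is onorm .

lift_definition zero_dual :: "'a dual" is "\<lambda>x. 0"
  by (rule bounded_linear_zero)

lift_definition plus_dual :: "'a dual \<Rightarrow> 'a dual \<Rightarrow> 'a dual" is "\<lambda>f g x. f x + g x"
  by (rule bounded_linear_add)

lift_definition minus_dual :: "'a dual \<Rightarrow> 'a dual \<Rightarrow> 'a dual" is "\<lambda>f g x. f x - g x"
  by (rule bounded_linear_sub)

lift_definition uminus_dual :: "'a dual \<Rightarrow> 'a dual" is "\<lambda>f x. - f x"
  by (rule bounded_linear_minus)

lift_definition scaleR_dual :: "real \<Rightarrow> 'a dual \<Rightarrow> 'a dual" is "\<lambda>c f x. c * f x"
  by (rule bounded_linear_const_mult)

definition sgn_dual :: "'a dual \<Rightarrow> 'a dual"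
  where "sgn_dual f = inverse (norm f) *\<^sub>R f"

definition dist_dual :: "'a dual \<Rightarrow> 'a dual \<Rightarrow> real"
  where "dist_dual f g = norm (f - g)"

definition uniformity_dual :: "('a dual \<times> 'a dual) filter"
  where "uniformity_dual = (INF e\<in>{0 <..}. principal {(f, g). dist f g < e})"

definition open_dual :: "'a dual set \<Rightarrow> bool"
  where "open_dual S = (\<forall>f\<in>S. \<forall>\<^sub>F (f', g) in uniformity. f' = f \<longrightarrow> g \<in> S)"

instance
  apply standard
  unfolding dist_dual_def open_dual_def sgn_dual_def uniformity_dual_def
  apply (rule refl |
      (transfer, force simp: onorm_triangle onorm_scaleR[where 'b = real, simplified] onorm_eq_0
        algebra_simps))+
  done

end

lemma dual_apply_simps [simp]:
  "dual_apply 0 x = 0"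
  "dual_apply (f + g) x = dual_apply f x + dual_apply g x"
  "dual_apply (f - g) x = dual_apply f x - dual_apply g x"
  "dual_apply (- f) x = - dual_apply f x"
  "dual_apply (c *\<^sub>R f) x = c * dual_apply f x"
  by (transfer, simp)+

lemma dual_apply_linear [simp]:
  "dual_apply f 0 = 0"
  "dual_apply f (x + y) = dual_apply f x + dual_apply f y"
  "dual_apply f (x - y) = dual_apply f x - dual_apply f y"
  "dual_apply f (- x) = - dual_apply f x"
  "dual_apply f (c *\<^sub>R x) = c * dual_apply f x"
  using bounded_linear_dual_apply[of f] by (simp_all add: linear_simps)

lemma abs_dual_apply_le: "\<bar>dual_apply f x\<bar> \<le> norm f * norm x"
  using onorm[OF bounded_linear_dual_apply, of f x] by (simp add: norm_dual.rep_eq)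

lemma norm_dual_le: "0 \<le> b \<Longrightarrow> (\<And>x. \<bar>dual_apply f x\<bar> \<le> b * norm x) \<Longrightarrow> norm f \<le> b"
  unfolding norm_dual.rep_eq by (rule onorm_bound) auto

instance dual :: (real_normed_vector) banach
proof
  fix X :: "nat \<Rightarrow> 'a dual"
  assume "Cauchy X"
  define B where "B = (\<lambda>f :: 'a dual. Blinfun (dual_apply f))"
  have B: "blinfun_apply (B f) = dual_apply f" for f
    by (simp add: B_def bounded_linear_Blinfun_apply bounded_linear_dual_apply)
  have Bdist: "dist (B f) (B g) = dist f g" for f g
    by (simp add: dist_norm norm_blinfun.rep_eq norm_dual.rep_eq minus_blinfun.rep_eq
        minus_dual.rep_eq B)
  have "Cauchy (\<lambda>n. B (X n))"
    using \<open>Cauchy X\<close> by (simp add: Cauchy_def Bdist)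
  then obtain L where L: "(\<lambda>n. B (X n)) \<longlonglongrightarrow> L"
    using Cauchy_convergent_iff convergent_def by blast
  have "L = B (Dual (blinfun_apply L))"
    by (rule blinfun_eqI) (simp add: B Dual_inverse blinfun.bounded_linear_right)
  then have "X \<longlonglongrightarrow> Dual (blinfun_apply L)"
    using L Bdist by (metis (mono_tags, lifting) lim_sequentially)
  then show "convergent X"
    by (auto simp: convergent_def)
qed

text \<open>Positive part of a functional on the positive cone, by the Riesz-Kantorovich formula.\<close>

definition cone_pos :: "'a::banach_lattice dual \<Rightarrow> 'a \<Rightarrow> real"
  where "cone_pos f u = (SUP y\<in>{0..u}. dual_apply f y)"

lemma dual_apply_interval_le:
  assumes "y \<in> {0..u}"
  shows "dual_apply f y \<le> norm f * norm (u :: 'a::banach_lattice)"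
proof -
  have "dual_apply f y \<le> norm f * norm y"
    using abs_dual_apply_le[of f y] by simp
  also have "\<dots> \<le> norm f * norm u"
    using assms by (intro mult_left_mono norm_mono_nonneg) auto
  finally show ?thesis .
qed

lemma bdd_above_cone_pos: "bdd_above (dual_apply f ` {0..u :: 'a::banach_lattice})"
  using dual_apply_interval_le by (intro bdd_aboveI2)

lemma cone_pos_upper: "0 \<le> y \<Longrightarrow> y \<le> u \<Longrightarrow> dual_apply f y \<le> cone_pos f u"
  unfolding cone_pos_def by (intro cSUP_upper bdd_above_cone_pos) auto

lemma cone_pos_least:
  assumes "0 \<le> u" "\<And>y. 0 \<le> y \<Longrightarrow> y \<le> u \<Longrightarrow> dual_apply f y \<le> b"
  shows "cone_pos f u \<le> b"
  unfolding cone_pos_def using assms by (intro cSUP_least) auto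

lemma cone_pos_nonneg: "0 \<le> u \<Longrightarrow> 0 \<le> cone_pos f u"
  using cone_pos_upper[of 0 u f] by simp

lemma cone_pos_add:
  assumes x: "0 \<le> x" and y: "0 \<le> y"
  shows "cone_pos f (x + y) = cone_pos f x + cone_pos f y"
proof (rule antisym)
  show "cone_pos f (x + y) \<le> cone_pos f x + cone_pos f y"
  proof (rule cone_pos_least)
    fix z assume z: "0 \<le> z" "z \<le> x + y"
    let ?z1 = "inf z x"
    have "z - ?z1 = sup 0 (z - x)"
      by (simp add: add_sup_distrib_left)
    then have z2: "0 \<le> z - ?z1" "z - ?z1 \<le> y"
      using z y by (auto simp: algebra_simps)
    have "dual_apply f z = dual_apply f ?z1 + dual_apply f (z - ?z1)"
      by (simp del: diff_inf_eq_sup)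
    also have "\<dots> \<le> cone_pos f x + cone_pos f y"
      using z x z2 by (intro add_mono cone_pos_upper) auto
    finally show "dual_apply f z \<le> cone_pos f x + cone_pos f y" .
  qed (use x y in simp)
  have "dual_apply f a \<le> cone_pos f (x + y) - cone_pos f y" if "0 \<le> a" "a \<le> x" for a
  proof -
    have "dual_apply f b \<le> cone_pos f (x + y) - dual_apply f a" if "0 \<le> b" "b \<le> y" for b
      using cone_pos_upper[of "a + b" "x + y" f] that \<open>0 \<le> a\<close> \<open>a \<le> x\<close> by (simp add: add_mono)
    then have "cone_pos f y \<le> cone_pos f (x + y) - dual_apply f a"
      using y by (intro cone_pos_least)
    then show ?thesis by simp
  qed
  then have "cone_pos f x \<le> cone_pos f (x + y) - cone_pos f y"
    using x by (intro cone_pos_least)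
  then show "cone_pos f x + cone_pos f y \<le> cone_pos f (x + y)" by simp
qed

lemma cone_pos_scaleR:
  assumes c: "0 \<le> c" and x: "0 \<le> x"
  shows "cone_pos f (c *\<^sub>R x) = c * cone_pos f x"
proof (cases "c = 0")
  case True
  then show ?thesis by (simp add: cone_pos_def)
next
  case False
  then have c: "0 < c" using c by simp
  have le: "cone_pos f (d *\<^sub>R u) \<le> d * cone_pos f u" if d: "0 < d" and u: "0 \<le> u" for d u
  proof (rule cone_pos_least)
    fix y assume y: "0 \<le> y" "y \<le> d *\<^sub>R u"
    have "0 \<le> inverse d *\<^sub>R y"
      using d y by (simp add: scaleR_nonneg_nonneg)
    moreover have "inverse d *\<^sub>R y \<le> u"
      using scaleR_left_mono[OF y(2), of "inverse d"] d by simp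
    ultimately have "dual_apply f (inverse d *\<^sub>R y) \<le> cone_pos f u"
      by (rule cone_pos_upper)
    then show "dual_apply f y \<le> d * cone_pos f u"
      using d by (simp add: field_simps)
  qed (use d u in \<open>simp add: scaleR_nonneg_nonneg\<close>)
  have "cone_pos f x \<le> inverse c * cone_pos f (c *\<^sub>R x)"
    using le[of "inverse c" "c *\<^sub>R x"] c x by (simp add: scaleR_nonneg_nonneg)
  then have "c * cone_pos f x \<le> cone_pos f (c *\<^sub>R x)"
    using c by (simp add: field_simps)
  then show ?thesis
    using le[OF c x] by (intro antisym)
qed

lemma cone_pos_le: "0 \<le> u \<Longrightarrow> cone_pos f u \<le> norm f * norm u"
  by (intro cone_pos_least dual_apply_interval_le) auto

definition dual_pos :: "'a::banach_lattice dual \<Rightarrow> 'a dual"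
  where "dual_pos f = Dual (\<lambda>x. cone_pos f (pprt x) - cone_pos f (pprt (- x)))"

lemma bounded_linear_dual_pos:
  "bounded_linear (\<lambda>x. cone_pos f (pprt x) - cone_pos f (pprt (- x)))"
proof -
  have "linear (\<lambda>x. cone_pos f (pprt x) - cone_pos f (pprt (- x)))"
    by (intro linear_extension_from_cone cone_pos_add cone_pos_scaleR)
  moreover have "norm (cone_pos f (pprt x) - cone_pos f (pprt (- x))) \<le> norm x * norm f" for x
  proof -
    have "cone_pos f (pprt z) \<le> norm f * norm x" if "norm z = norm x" for z
      using cone_pos_le[of "pprt z" f] mult_left_mono[OF norm_pprt_le[of z], of "norm f"] that
      by simp
    from this[of x] this[of "- x"] show ?thesis
      using cone_pos_nonneg[of "pprt x" f] cone_pos_nonneg[of "pprt (- x)" f]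
      by (simp add: abs_le_iff mult.commute)
  qed
  ultimately show ?thesis
    by (auto simp: bounded_linear_def bounded_linear_axioms_def)
qed

lemma dual_pos_apply:
  assumes "0 \<le> x"
  shows "dual_apply (dual_pos f) x = cone_pos f x"
  using assms cone_pos_scaleR[of 0 0 f]
  by (simp add: dual_pos_def Dual_inverse bounded_linear_dual_pos)

instantiation dual :: (banach_lattice) banach_lattice
begin

definition less_eq_dual :: "'a dual \<Rightarrow> 'a dual \<Rightarrow> bool"
  where "f \<le> g \<longleftrightarrow> (\<forall>x\<ge>0. dual_apply f x \<le> dual_apply g x)"

definition less_dual :: "'a dual \<Rightarrow> 'a dual \<Rightarrow> bool"
  where "f < g \<longleftrightarrow> f \<le> g \<and> \<not> g \<le> f" for f g :: "'a dual"

definition sup_dual :: "'a dual \<Rightarrow> 'a dual \<Rightarrow> 'a dual"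
  where "sup_dual f g = f + dual_pos (g - f)"

definition inf_dual :: "'a dual \<Rightarrow> 'a dual \<Rightarrow> 'a dual"
  where "inf_dual f g = - sup (- f) (- g)"

definition abs_dual :: "'a dual \<Rightarrow> 'a dual"
  where "abs_dual f = sup f (- f)"

instance
proof
  fix f g h :: "'a dual" and a b :: real
  show "f < g \<longleftrightarrow> f \<le> g \<and> \<not> g \<le> f" by (rule less_dual_def)
  show "f \<le> f" by (simp add: less_eq_dual_def)
  show "f \<le> g \<Longrightarrow> g \<le> h \<Longrightarrow> f \<le> h" by (force simp: less_eq_dual_def)
  show "f = g" if "f \<le> g" "g \<le> f"
  proof (rule dual_eqI)
    fix x
    have eq: "dual_apply f y = dual_apply g y" if "0 \<le> y" for y
      using \<open>f \<le> g\<close> \<open>g \<le> f\<close> that by (auto simp: less_eq_dual_def intro: antisym)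
    show "dual_apply f x = dual_apply g x"
      by (subst (1 2) pprt_diff[of x]) (simp add: eq)
  qed
  show "f \<le> g \<Longrightarrow> h + f \<le> h + g" by (simp add: less_eq_dual_def)
  show "f \<le> g \<Longrightarrow> 0 \<le> a \<Longrightarrow> a *\<^sub>R f \<le> a *\<^sub>R g"
    by (simp add: less_eq_dual_def mult_left_mono)
  show "a \<le> b \<Longrightarrow> 0 \<le> f \<Longrightarrow> a *\<^sub>R f \<le> b *\<^sub>R f"
    by (simp add: less_eq_dual_def mult_right_mono)
  have sup1: "f \<le> sup f g" for f g :: "'a dual"
    by (simp add: less_eq_dual_def sup_dual_def dual_pos_apply cone_pos_nonneg)
  have sup2: "g \<le> sup f g" for f g :: "'a dual"
    unfolding less_eq_dual_def sup_dual_def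
  proof (intro allI impI)
    fix x :: 'a assume "0 \<le> x"
    then show "dual_apply g x \<le> dual_apply (f + dual_pos (g - f)) x"
      using cone_pos_upper[of x x "g - f"] by (simp add: dual_pos_apply)
  qed
  have sup3: "sup f g \<le> h" if "f \<le> h" "g \<le> h" for f g h :: "'a dual"
    unfolding less_eq_dual_def sup_dual_def
  proof (intro allI impI)
    fix x :: 'a assume x: "0 \<le> x"
    have "cone_pos (g - f) x \<le> dual_apply (h - f) x"
    proof (rule cone_pos_least[OF x])
      fix y assume y: "0 \<le> y" "y \<le> x"
      then have "dual_apply g y \<le> dual_apply h y"
        using that by (simp add: less_eq_dual_def)
      moreover have "dual_apply f (x - y) \<le> dual_apply h (x - y)"
        using that y by (simp only: less_eq_dual_def diff_ge_0_iff_ge)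
      ultimately show "dual_apply (g - f) y \<le> dual_apply (h - f) x" by simp
    qed
    then show "dual_apply (f + dual_pos (g - f)) x \<le> dual_apply h x"
      using x by (simp add: dual_pos_apply)
  qed
  have neg: "- f \<le> - g \<longleftrightarrow> g \<le> f" for f g :: "'a dual"
    by (simp add: less_eq_dual_def)
  show "f \<le> sup f g" "g \<le> sup f g" by (rule sup1, rule sup2)
  show "g \<le> f \<Longrightarrow> h \<le> f \<Longrightarrow> sup g h \<le> f" by (rule sup3)
  show "inf f g \<le> f" "inf f g \<le> g"
    using sup1[of "- f" "- g"] sup2[of "- g" "- f"] neg[of f "inf f g"] neg[of g "inf f g"]
    by (simp_all add: inf_dual_def)
  show "f \<le> inf g h" if "f \<le> g" "f \<le> h"
    using sup3[of "- g" "- f" "- h"] that neg[of "inf g h" f] by (simp add: inf_dual_def neg)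
  show "\<bar>f\<bar> = sup f (- f)" by (rule abs_dual_def)
  have abs_apply: "dual_apply f x \<le> dual_apply \<bar>f\<bar> \<bar>x\<bar>" for f :: "'a dual" and x
  proof -
    have "dual_apply f (pprt x) \<le> dual_apply \<bar>f\<bar> (pprt x)"
      using sup1[of f "- f"] by (simp add: less_eq_dual_def abs_dual_def)
    moreover have "dual_apply (- f) (pprt (- x)) \<le> dual_apply \<bar>f\<bar> (pprt (- x))"
      using sup2[of "- f" f] unfolding less_eq_dual_def abs_dual_def by (meson zero_le_pprt)
    moreover have "dual_apply f x = dual_apply f (pprt x) - dual_apply f (pprt (- x))"
      by (subst pprt_diff[of x]) simp
    moreover have "\<bar>x\<bar> = pprt x + pprt (- x)"
      by (simp add: abs_prts pprt_neg)
    ultimately show ?thesis by simp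
  qed
  have abs_le_norm: "dual_apply \<bar>g\<bar> u \<le> norm g * norm u" if u: "0 \<le> u" for g :: "'a dual" and u
  proof -
    have "cone_pos (- g - g) u \<le> norm g * norm u - dual_apply g u"
    proof (rule cone_pos_least[OF u])
      fix y assume y: "0 \<le> y" "y \<le> u"
      have "u - y - y \<le> u" "- (u - y - y) \<le> u"
        using y by (auto simp: algebra_simps add_increasing intro: add_mono order_trans)
      then have "\<bar>u - y - y\<bar> \<le> \<bar>u\<bar>"
        using u by (auto intro!: abs_leI)
      then have "norm g * norm (u - y - y) \<le> norm g * norm u"
        by (intro mult_left_mono norm_le_if_abs_le) auto
      then show "dual_apply (- g - g) y \<le> norm g * norm u - dual_apply g u"
        using abs_dual_apply_le[of g "u - y - y"] by simp
    qed
    then show ?thesis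
      using u by (simp add: abs_dual_def sup_dual_def dual_pos_apply)
  qed
  show "norm f \<le> norm g" if "\<bar>f\<bar> \<le> \<bar>g\<bar>"
  proof (rule norm_dual_le)
    fix x
    have "dual_apply f z \<le> norm g * norm z" for z
    proof -
      have "dual_apply f z \<le> dual_apply \<bar>f\<bar> \<bar>z\<bar>" by (rule abs_apply)
      also have "\<dots> \<le> dual_apply \<bar>g\<bar> \<bar>z\<bar>"
        using that by (simp add: less_eq_dual_def)
      also have "\<dots> \<le> norm g * norm z"
        using abs_le_norm[of "\<bar>z\<bar>" g] by simp
      finally show ?thesis .
    qed
    from this[of x] this[of "- x"] show "\<bar>dual_apply f x\<bar> \<le> norm g * norm x"
      by (simp add: abs_le_iff)
  qed simp
qed

end


section \<open>Regular operators and their adjoints\<close>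

definition positive_operator :: "('a::banach_lattice \<Rightarrow> 'b::banach_lattice) \<Rightarrow> bool"
  where "positive_operator T \<longleftrightarrow> linear T \<and> (\<forall>x\<ge>0. 0 \<le> T x)"

definition regular_operator :: "('a::banach_lattice \<Rightarrow> 'b::banach_lattice) \<Rightarrow> bool"
  where "regular_operator T \<longleftrightarrow>
    (\<exists>P Q. positive_operator P \<and> positive_operator Q \<and> T = (\<lambda>x. P x - Q x))"

text \<open>Only meaningful for bounded \<open>T\<close>, as otherwise \<open>Dual\<close> is applied outside its domain. Regular
  operators are bounded, see \<open>regular_operator_bounded\<close> below.\<close>

definition dual_adjoint ::
    "('a::real_normed_vector \<Rightarrow> 'b::real_normed_vector) \<Rightarrow> 'b dual \<Rightarrow> 'a dual"
  where "dual_adjoint T f = Dual (\<lambda>x. dual_apply f (T x))"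

lemma positive_operator_bounded:
  fixes T :: "'a::banach_lattice \<Rightarrow> 'b::banach_lattice"
  assumes "positive_operator T"
  shows "bounded_linear T"
proof -
  interpret linear T using assms by (simp add: positive_operator_def)
  have pos: "0 \<le> T x" if "0 \<le> x" for x
    using assms that by (simp add: positive_operator_def)
  have mono: "T x \<le> T y" if "x \<le> y" for x y
    using pos[of "y - x"] that by (simp add: diff)
  have "\<exists>K. \<forall>x\<ge>0. norm x \<le> 1 \<longrightarrow> norm (T x) \<le> K"
  proof (rule ccontr)
    assume "\<not> ?thesis"
    then have "\<forall>n::nat. \<exists>x\<ge>0. norm x \<le> 1 \<and> norm (T x) > 4 ^ n"
      by (auto simp: not_le)
    from choice[OF this] obtain x where x: "\<And>n. 0 \<le> x n" "\<And>n. norm (x n) \<le> 1"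
      and big: "\<And>n::nat. norm (T (x n)) > 4 ^ n"
      by auto
    define y where "y n = (1/2) ^ n *\<^sub>R x n" for n
    have y0: "0 \<le> y n" for n using x by (simp add: y_def scaleR_nonneg_nonneg)
    have "norm (y n) \<le> (1/2) ^ n" for n
      using x(2)[of n] by (simp add: y_def mult_left_le)
    then have sm: "summable y"
      using summable_comparison_test'[of "\<lambda>n. (1/2::real) ^ n" 0 y] by (simp add: summable_geometric)
    have le: "y n \<le> suminf y" for n
    proof -
      have "(\<lambda>m. (\<Sum>i<m. y i) - y n) \<longlonglongrightarrow> suminf y - y n"
        by (intro tendsto_intros summable_LIMSEQ sm)
      moreover have "\<forall>\<^sub>F m in sequentially. (\<Sum>i<m. y i) - y n \<in> {x. 0 \<le> x}"
        using eventually_gt_at_top[of n]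
      proof eventually_elim
        case (elim m)
        have "(\<Sum>i<m. y i) - y n = (\<Sum>i\<in>{..<m} - {n}. y i)"
          using elim by (subst sum.remove[of _ n]) auto
        then show ?case by (simp add: sum_nonneg y0)
      qed
      ultimately have "suminf y - y n \<in> {x. 0 \<le> x}"
        by (intro Lim_in_closed_set[OF closed_nonneg_cone _ sequentially_bot])
      then show ?thesis by simp
    qed
    have "2 ^ n \<le> norm (T (suminf y))" for n
    proof -
      have "2 ^ n = (1/2) ^ n * (4::real) ^ n"
        using power_mult_distrib[of "1/2::real" 4 n] by simp
      also have "\<dots> \<le> (1/2) ^ n * norm (T (x n))"
        using big[of n] by (intro mult_left_mono) auto
      also have "\<dots> = norm (T (y n))" by (simp add: y_def scale)
      also have "\<dots> \<le> norm (T (suminf y))"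
        by (intro norm_mono_nonneg pos mono y0 le)
      finally show ?thesis .
    qed
    then show False
      using real_arch_pow[of 2 "norm (T (suminf y))"] by (simp add: linorder_not_le[symmetric])
  qed
  then obtain K where K: "\<And>x. 0 \<le> x \<Longrightarrow> norm x \<le> 1 \<Longrightarrow> norm (T x) \<le> K" by blast
  have pos_bound: "norm (T x) \<le> K * norm x" if "0 \<le> x" for x
  proof (cases "x = 0")
    case False
    then have "norm (T (inverse (norm x) *\<^sub>R x)) \<le> K"
      using that by (intro K) (auto simp: scaleR_nonneg_nonneg)
    then show ?thesis using False by (simp add: scale field_simps)
  qed (simp add: zero)
  have "norm (T x) \<le> norm x * (2 * K)" for x
  proof -
    have "K \<ge> 0" using K[of 0] by (simp add: zero)
    have b: "norm (T (pprt z)) \<le> K * norm x" if "norm z = norm x" for z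
      using pos_bound[of "pprt z"] mult_left_mono[OF norm_pprt_le[of z] \<open>K \<ge> 0\<close>] that by simp
    have "T x = T (pprt x) - T (pprt (- x))"
      by (subst pprt_diff[of x]) (simp add: diff)
    then have "norm (T x) \<le> norm (T (pprt x)) + norm (T (pprt (- x)))"
      by (simp add: norm_triangle_ineq4)
    then show ?thesis using b[of x] b[of "- x"] by (simp add: algebra_simps)
  qed
  then show ?thesis
    by (auto simp: bounded_linear_def bounded_linear_axioms_def linear_axioms)
qed

lemma regular_operator_bounded: "regular_operator T \<Longrightarrow> bounded_linear T"
  by (auto simp: regular_operator_def intro: bounded_linear_sub positive_operator_bounded)

lemma dual_adjoint_apply:
  assumes "bounded_linear T"
  shows "dual_apply (dual_adjoint T f) x = dual_apply f (T x)"
  using bounded_linear_compose[OF bounded_linear_dual_apply assms, of f]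
  by (simp add: dual_adjoint_def Dual_inverse)


section \<open>The positive Schur property and almost Dunford-Pettis operators\<close>

definition weakly_null :: "(nat \<Rightarrow> 'a::real_normed_vector) \<Rightarrow> bool"
  where "weakly_null x \<longleftrightarrow> (\<forall>\<phi> :: 'a dual. (\<lambda>n. dual_apply \<phi> (x n)) \<longlonglongrightarrow> 0)"

definition disjoint_sequence :: "(nat \<Rightarrow> 'a::banach_lattice) \<Rightarrow> bool"
  where "disjoint_sequence x \<longleftrightarrow> (\<forall>m n. m \<noteq> n \<longrightarrow> inf \<bar>x m\<bar> \<bar>x n\<bar> = 0)"

definition positive_schur :: "'a::banach_lattice itself \<Rightarrow> bool"
  where "positive_schur _ \<longleftrightarrow>
    (\<forall>x :: nat \<Rightarrow> 'a. (\<forall>n. 0 \<le> x n) \<longrightarrow> weakly_null x \<longrightarrow> x \<longlonglongrightarrow> 0)"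

definition almost_dunford_pettis :: "('a::banach_lattice \<Rightarrow> 'b::banach) \<Rightarrow> bool"
  where "almost_dunford_pettis T \<longleftrightarrow> linear T \<and>
    (\<forall>x. disjoint_sequence x \<longrightarrow> weakly_null x \<longrightarrow> (\<lambda>n. T (x n)) \<longlonglongrightarrow> 0)"

end

theory Submission
  imports Defs
begin

text \<open>If \<open>P\<close> is a positive operator, \<open>\<bar>P\<^sup>* f\<bar> \<le> P\<^sup>* \<bar>f\<bar>\<close>, and \<open>P\<^sup>*\<close> is positive and weakly
  continuous. So the positive Schur property of \<open>E\<^sup>*\<close> gives \<open>P\<^sup>* f\<^sub>n \<longlonglongrightarrow> 0\<close> whenever the moduli
  \<open>\<bar>f\<^sub>n\<bar>\<close> are weakly null, and regular operators follow by taking differences.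

  What remains is a fact about an arbitrary Banach lattice: a disjoint weakly null sequence
  \<open>x\<^sub>n\<close> has weakly null moduli (\<open>weakly_null_abs\<close>). Weak convergence passes to moduli only because of
  disjointness: a positive functional \<open>\<phi>\<close> has a component \<open>\<psi>\<close> that agrees with \<open>\<phi>\<close> on the
  positive elements disjoint from every negative part \<open>x\<^sub>m\<^sup>-\<close>, and annihilates every \<open>x\<^sub>m\<^sup>-\<close>
  (\<open>functional_component\<close>). As each \<open>x\<^sub>n\<^sup>+\<close> is disjoint from each \<open>x\<^sub>m\<^sup>-\<close>, the single functional
  \<open>\<psi>\<close> satisfies \<open>\<psi> x\<^sub>n = \<phi> x\<^sub>n\<^sup>+\<close> for all \<open>n\<close>. Hence \<open>\<phi> x\<^sub>n\<^sup>+\<close> tends to \<open>0\<close>, and so does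
  \<open>\<phi> \<bar>x\<^sub>n\<bar> = 2 \<phi> x\<^sub>n\<^sup>+ - \<phi> x\<^sub>n\<close>.\<close>

section \<open>Components of positive functionals\<close>

lemma dual_apply_mono:
  assumes "0 \<le> \<phi>" "x \<le> y"
  shows "dual_apply \<phi> x \<le> dual_apply \<phi> y"
proof -
  have "0 \<le> dual_apply \<phi> (y - x)"
    using assms by (simp only: less_eq_dual_def dual_apply_simps diff_ge_0_iff_ge)
  then show ?thesis by simp
qed

lemma ex_dual_eq_on_cone:
  fixes p :: "'a::banach_lattice \<Rightarrow> real"
  assumes add: "\<And>x y. 0 \<le> x \<Longrightarrow> 0 \<le> y \<Longrightarrow> p (x + y) = p x + p y"
    and scale: "\<And>c x. 0 \<le> c \<Longrightarrow> 0 \<le> x \<Longrightarrow> p (c *\<^sub>R x) = c * p x"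
    and nonneg: "\<And>x. 0 \<le> x \<Longrightarrow> 0 \<le> p x"
    and bound: "\<And>x. 0 \<le> x \<Longrightarrow> p x \<le> K * norm x" and K: "0 \<le> K"
  shows "\<exists>\<psi>. \<forall>x\<ge>0. dual_apply \<psi> x = p x"
proof -
  let ?P = "\<lambda>x. p (pprt x) - p (pprt (- x))"
  have "linear ?P"
    by (intro linear_extension_from_cone add scale)
  moreover have "norm (?P x) \<le> norm x * K" for x
  proof -
    have "p (pprt z) \<le> K * norm z" for z
      using bound[of "pprt z"] mult_left_mono[OF norm_pprt_le[of z] K] by simp
    from this[of x] this[of "- x"] show ?thesis
      using nonneg[of "pprt x"] nonneg[of "pprt (- x)"] by (simp add: abs_le_iff mult.commute)
  qed
  ultimately have "bounded_linear ?P"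
    by (auto simp: bounded_linear_def bounded_linear_axioms_def)
  then have "\<forall>x\<ge>0. dual_apply (Dual ?P) x = p x"
    using scale[of 0 0] by (simp add: Dual_inverse)
  then show ?thesis by blast
qed

text \<open>This is the Riesz-Kantorovich supremum restricted to a solid subcone \<open>A\<close>. For additivity, an
  element \<open>z \<in> A\<close> below \<open>x + y\<close> is split as \<open>inf z x + (z - inf z x)\<close>; both summands lie between
  \<open>0\<close> and \<open>z\<close>, so solidity keeps them in \<open>A\<close>.\<close>

lemma functional_carried_by_solid_cone:
  fixes \<phi> :: "'a::banach_lattice dual" and A :: "'a set"
  assumes \<phi>: "0 \<le> \<phi>"
    and pos: "\<And>x. x \<in> A \<Longrightarrow> 0 \<le> x" and zero: "0 \<in> A"
    and add: "\<And>x y. x \<in> A \<Longrightarrow> y \<in> A \<Longrightarrow> x + y \<in> A"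
    and scale: "\<And>c x. 0 < c \<Longrightarrow> x \<in> A \<Longrightarrow> c *\<^sub>R x \<in> A"
    and solid: "\<And>x y. 0 \<le> x \<Longrightarrow> x \<le> y \<Longrightarrow> y \<in> A \<Longrightarrow> x \<in> A"
  shows "\<exists>\<psi>. \<forall>x\<ge>0. dual_apply \<psi> x = (SUP z\<in>{z \<in> A. z \<le> x}. dual_apply \<phi> z)"
proof -
  define p where "p x = (SUP z\<in>{z \<in> A. z \<le> x}. dual_apply \<phi> z)" for x
  have upper: "dual_apply \<phi> z \<le> p x" if "z \<in> A" "z \<le> x" for z x
    unfolding p_def using that dual_apply_mono[OF \<phi>] by (intro cSUP_upper bdd_aboveI2) auto
  have least: "p x \<le> b" if "0 \<le> x" "\<And>z. z \<in> A \<Longrightarrow> z \<le> x \<Longrightarrow> dual_apply \<phi> z \<le> b" for x b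
    unfolding p_def using that zero by (intro cSUP_least) auto
  have p_add: "p (x + y) = p x + p y" if x: "0 \<le> x" and y: "0 \<le> y" for x y
  proof (rule antisym)
    show "p (x + y) \<le> p x + p y"
    proof (rule least)
      fix z assume z: "z \<in> A" "z \<le> x + y"
      let ?z1 = "inf z x"
      have "z - ?z1 = sup 0 (z - x)"
        by (simp add: add_sup_distrib_left)
      then have z2: "0 \<le> z - ?z1" "z - ?z1 \<le> y"
        using z y by (auto simp: algebra_simps)
      have z1: "0 \<le> ?z1" using pos z x by simp
      have "dual_apply \<phi> z = dual_apply \<phi> ?z1 + dual_apply \<phi> (z - ?z1)"
        by (simp del: diff_inf_eq_sup)
      also have "\<dots> \<le> p x + p y"
      proof (intro add_mono upper z2)
        show "?z1 \<in> A" using solid[OF z1 _ z(1)] by simp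
        have "z - ?z1 \<le> z" using z1 by (simp del: diff_inf_eq_sup)
        then show "z - ?z1 \<in> A" using solid z2(1) z(1) by blast
      qed simp
      finally show "dual_apply \<phi> z \<le> p x + p y" .
    qed (use x y in simp)
    have "dual_apply \<phi> a \<le> p (x + y) - p y" if a: "a \<in> A" "a \<le> x" for a
    proof -
      have "dual_apply \<phi> b \<le> p (x + y) - dual_apply \<phi> a" if "b \<in> A" "b \<le> y" for b
        using upper[of "a + b" "x + y"] that a by (simp add: add add_mono)
      then have "p y \<le> p (x + y) - dual_apply \<phi> a"
        using y by (intro least)
      then show ?thesis by simp
    qed
    then have "p x \<le> p (x + y) - p y" using x by (intro least)
    then show "p x + p y \<le> p (x + y)" by simp
  qed
  have p_scale_le: "p (d *\<^sub>R u) \<le> d * p u" if d: "0 < d" and u: "0 \<le> u" for d u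
  proof (rule least)
    fix z assume z: "z \<in> A" "z \<le> d *\<^sub>R u"
    have "inverse d *\<^sub>R z \<le> u"
      using scaleR_left_mono[OF z(2), of "inverse d"] d by simp
    then have "dual_apply \<phi> (inverse d *\<^sub>R z) \<le> p u"
      using scale[of "inverse d"] d z by (intro upper) auto
    then show "dual_apply \<phi> z \<le> d * p u"
      using d by (simp add: field_simps)
  qed (use d u in \<open>simp add: scaleR_nonneg_nonneg\<close>)
  have p_scale: "p (c *\<^sub>R x) = c * p x" if c: "0 \<le> c" and x: "0 \<le> x" for c x
  proof (cases "c = 0")
    case True
    then show ?thesis using p_add[of 0 0] by simp
  next
    case False
    then have c: "0 < c" using c by simp
    have "p x \<le> inverse c * p (c *\<^sub>R x)"
      using p_scale_le[of "inverse c" "c *\<^sub>R x"] c x by (simp add: scaleR_nonneg_nonneg)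
    then have "c * p x \<le> p (c *\<^sub>R x)"
      using c by (simp add: field_simps)
    then show ?thesis using p_scale_le[OF c x] by (intro antisym)
  qed
  have "p x \<le> norm \<phi> * norm x" if "0 \<le> x" for x
    using that pos by (intro least dual_apply_interval_le) auto
  moreover have "0 \<le> p x" if "0 \<le> x" for x
    using upper[OF zero that] by simp
  ultimately show ?thesis
    using ex_dual_eq_on_cone[of p "norm \<phi>"] p_add p_scale by (simp add: p_def)
qed

text \<open>The positive elements disjoint from \<open>D\<close> form a solid cone \<open>A\<close>, to which the supremum above
  applies. On \<open>A\<close> the supremum is attained at the element itself. An element of \<open>A\<close> below some
  \<open>d \<in> D\<close> equals its infimum with \<open>d\<close>, hence is \<open>0\<close>, and so the functional vanishes on \<open>D\<close>.\<close>

lemma functional_component: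
  fixes \<phi> :: "'a::banach_lattice dual" and D :: "'a set"
  assumes \<phi>: "0 \<le> \<phi>" and D: "\<And>d. d \<in> D \<Longrightarrow> 0 \<le> d"
  shows "\<exists>\<psi>. (\<forall>x\<ge>0. (\<forall>d\<in>D. inf x d = 0) \<longrightarrow> dual_apply \<psi> x = dual_apply \<phi> x) \<and>
    (\<forall>d\<in>D. dual_apply \<psi> d = 0)"
proof -
  define A where "A = {x. 0 \<le> x \<and> (\<forall>d\<in>D. inf x d = 0)}"
  have "\<exists>\<psi>. \<forall>x\<ge>0. dual_apply \<psi> x = (SUP z\<in>{z \<in> A. z \<le> x}. dual_apply \<phi> z)"
  proof (rule functional_carried_by_solid_cone[OF \<phi>])
    show "0 \<in> A" using D by (auto simp: A_def inf_absorb1)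
    show "x \<in> A" if "0 \<le> x" "x \<le> y" "y \<in> A" for x y
    proof -
      have "inf x d = 0" if "d \<in> D" for d
      proof (rule antisym)
        have "inf x d \<le> inf y d" using \<open>x \<le> y\<close> by (rule inf_mono) simp
        also have "\<dots> = 0" using \<open>y \<in> A\<close> that by (simp add: A_def)
        finally show "inf x d \<le> 0" .
        show "0 \<le> inf x d" using \<open>0 \<le> x\<close> D[OF that] by simp
      qed
      then show ?thesis using that by (simp add: A_def)
    qed
    show "x + y \<in> A" if "x \<in> A" "y \<in> A" for x y
    proof -
      have "inf (x + y) d = 0" if d: "d \<in> D" for d
      proof (rule antisym)
        have xy: "0 \<le> x" "0 \<le> y" "inf x d = 0" "inf y d = 0"
          using \<open>x \<in> A\<close> \<open>y \<in> A\<close> d by (auto simp: A_def)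
        let ?w = "inf (x + y) d"
        \<comment> \<open>As \<open>w \<le> x + y\<close> and \<open>w \<le> d\<close>, the element \<open>w - x\<close> lies below both \<open>y\<close> and \<open>d\<close>.\<close>
        have "?w - x \<le> y" by (simp add: diff_le_eq add.commute)
        moreover have "?w - x \<le> d"
          using xy(1) by (simp add: diff_le_eq add_increasing2 le_infI2)
        ultimately have "?w - x \<le> 0" using xy(4) le_inf_iff by metis
        then have "?w \<le> inf x d" by simp
        then show "?w \<le> 0" using xy(3) by simp
        show "0 \<le> ?w" using xy D[OF d] by simp
      qed
      then show ?thesis using that by (simp add: A_def)
    qed
    show "c *\<^sub>R x \<in> A" if c: "0 < c" and x: "x \<in> A" for c x
    proof -
      have "inf (c *\<^sub>R x) d = 0" if d: "d \<in> D" for d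
      proof (rule antisym)
        have xd: "0 \<le> x" "inf x d = 0" "0 \<le> d" using x d D by (auto simp: A_def)
        let ?w = "inf (c *\<^sub>R x) d" and ?m = "inverse (max 1 c)"
        have m: "0 < ?m" "?m * c \<le> 1" "?m \<le> 1" by (auto simp: field_simps max_def)
        \<comment> \<open>The factor \<open>m\<close> is small enough for \<open>m w\<close> to lie below both \<open>x\<close> and \<open>d\<close>.\<close>
        have "?m *\<^sub>R ?w \<le> ?m *\<^sub>R c *\<^sub>R x"
          using m by (intro scaleR_left_mono) auto
        also have "\<dots> \<le> x"
          using scaleR_right_mono[OF m(2) xd(1)] by simp
        finally have 1: "?m *\<^sub>R ?w \<le> x" .
        have "?m *\<^sub>R ?w \<le> ?m *\<^sub>R d"
          using m by (intro scaleR_left_mono) auto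
        also have "\<dots> \<le> d"
          using scaleR_right_mono[OF m(3) xd(3)] by simp
        finally have "?m *\<^sub>R ?w \<le> 0" using 1 xd(2) le_inf_iff by metis
        then have "max 1 c *\<^sub>R ?m *\<^sub>R ?w \<le> max 1 c *\<^sub>R 0"
          by (intro scaleR_left_mono) auto
        moreover have "max 1 c * ?m = 1" by simp
        ultimately show "?w \<le> 0"
          by (metis scaleR_one scaleR_scaleR scaleR_zero_right)
        show "0 \<le> ?w" using c xd by (simp add: scaleR_nonneg_nonneg)
      qed
      then show ?thesis using c x by (simp add: A_def scaleR_nonneg_nonneg)
    qed
  qed (simp add: A_def)
  then obtain \<psi> where
    \<psi>: "\<And>x. 0 \<le> x \<Longrightarrow> dual_apply \<psi> x = (SUP z\<in>{z \<in> A. z \<le> x}. dual_apply \<phi> z)"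
    by blast
  show ?thesis
  proof (intro exI conjI allI ballI impI)
    fix x assume x: "0 \<le> x" "\<forall>d\<in>D. inf x d = 0"
    have "x \<in> A" using x by (simp add: A_def)
    then show "dual_apply \<psi> x = dual_apply \<phi> x"
      using x dual_apply_mono[OF \<phi>] by (simp add: \<psi>) (intro cSup_eq_maximum; auto)
  next
    fix d assume d: "d \<in> D"
    have "z = 0" if "z \<in> A" "z \<le> d" for z
      using that d by (auto simp: A_def inf_absorb1)
    then have "{z \<in> A. z \<le> d} = {0}"
      using D d by (auto simp: A_def inf_absorb1)
    then show "dual_apply \<psi> d = 0" using D d by (simp add: \<psi>)
  qed
qed

section \<open>Moduli of disjoint weakly null sequences\<close>

lemma inf_pprt_pprt_minus: "inf (pprt x) (pprt (- x)) = (0 :: 'a::banach_lattice)"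
proof -
  have "inf (pprt x) (pprt (- x)) = inf (pprt (- x) + x) (pprt (- x) + 0)"
    by (subst pprt_diff[of x]) simp
  also have "\<dots> = pprt (- x) + inf x 0"
    by (rule add_inf_distrib_left[symmetric])
  also have "\<dots> = 0"
    unfolding pprt_neg nprt_def by (rule left_minus)
  finally show ?thesis .
qed

lemma disjoint_sequence_pprt_disjoint:
  assumes "disjoint_sequence x"
  shows "inf (pprt (x n)) (pprt (- x m)) = 0"
proof (cases "m = n")
  case False
  have "inf (pprt (x n)) (pprt (- x m)) \<le> inf \<bar>x n\<bar> \<bar>x m\<bar>"
    using pprt_le_abs[of "x n"] pprt_le_abs[of "- x m"] by (intro inf_mono) auto
  also have "\<dots> = 0" using assms False by (simp add: disjoint_sequence_def)
  finally show ?thesis by (intro antisym) auto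
qed (simp add: inf_pprt_pprt_minus)

text \<open>One functional has to serve all \<open>n\<close> at once, because weak nullity only controls a fixed
  functional along the sequence; the component of \<open>\<phi>\<close> disjoint from all negative parts does.\<close>

lemma weakly_null_abs:
  fixes x :: "nat \<Rightarrow> 'a::banach_lattice"
  assumes disj: "disjoint_sequence x" and null: "weakly_null x"
  shows "weakly_null (\<lambda>n. \<bar>x n\<bar>)"
proof -
  have pos: "(\<lambda>n. dual_apply \<phi> \<bar>x n\<bar>) \<longlonglongrightarrow> 0" if \<phi>: "0 \<le> \<phi>" for \<phi>
  proof -
    define D where "D = range (\<lambda>m. pprt (- x m))"
    have D: "0 \<le> d" if "d \<in> D" for d
      using that by (auto simp: D_def)
    obtain \<psi> where
      \<psi>1: "\<And>y. 0 \<le> y \<Longrightarrow> (\<And>d. d \<in> D \<Longrightarrow> inf y d = 0) \<Longrightarrow> dual_apply \<psi> y = dual_apply \<phi> y" and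
      \<psi>2: "\<And>d. d \<in> D \<Longrightarrow> dual_apply \<psi> d = 0"
      using functional_component[OF \<phi>, of D] D by blast
    have "dual_apply \<psi> (x n) = dual_apply \<phi> (pprt (x n))" for n
    proof -
      have "dual_apply \<psi> (pprt (x n)) = dual_apply \<phi> (pprt (x n))"
        using disjoint_sequence_pprt_disjoint[OF disj] by (intro \<psi>1) (auto simp: D_def)
      moreover have "dual_apply \<psi> (pprt (- x n)) = 0" by (intro \<psi>2) (simp add: D_def)
      ultimately show ?thesis by (subst pprt_diff) simp
    qed
    moreover have "dual_apply \<phi> \<bar>x n\<bar> = 2 * dual_apply \<phi> (pprt (x n)) - dual_apply \<phi> (x n)" for n
    proof -
      have "\<bar>x n\<bar> = pprt (x n) + pprt (- x n)"
        by (simp add: abs_prts pprt_neg)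
      moreover have "dual_apply \<phi> (x n) = dual_apply \<phi> (pprt (x n)) - dual_apply \<phi> (pprt (- x n))"
        by (subst pprt_diff[of "x n"]) simp
      ultimately show ?thesis by simp
    qed
    ultimately have "dual_apply \<phi> \<bar>x n\<bar> = 2 * dual_apply \<psi> (x n) - dual_apply \<phi> (x n)" for n
      by simp
    moreover have "(\<lambda>n. 2 * dual_apply \<psi> (x n) - dual_apply \<phi> (x n)) \<longlonglongrightarrow> 2 * 0 - 0"
      using null by (intro tendsto_intros) (auto simp: weakly_null_def)
    ultimately show ?thesis by simp
  qed
  show ?thesis
    unfolding weakly_null_def
  proof
    fix \<phi> :: "'a dual"
    have "(\<lambda>n. dual_apply (pprt \<phi>) \<bar>x n\<bar> - dual_apply (pprt (- \<phi>)) \<bar>x n\<bar>) \<longlonglongrightarrow> 0 - 0"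
      by (intro tendsto_diff pos) auto
    then show "(\<lambda>n. dual_apply \<phi> \<bar>x n\<bar>) \<longlonglongrightarrow> 0"
      by (subst pprt_diff[of \<phi>]) simp
  qed
qed

section \<open>Adjoints of regular operators\<close>

lemma bounded_linear_dual_adjoint:
  assumes T: "bounded_linear T"
  shows "bounded_linear (dual_adjoint T)"
proof (rule bounded_linear_intro)
  show "dual_adjoint T (f + g) = dual_adjoint T f + dual_adjoint T g" for f g
    by (rule dual_eqI) (simp add: dual_adjoint_apply[OF T])
  show "dual_adjoint T (c *\<^sub>R f) = c *\<^sub>R dual_adjoint T f" for c f
    by (rule dual_eqI) (simp add: dual_adjoint_apply[OF T])
  show "norm (dual_adjoint T f) \<le> norm f * onorm T" for f
  proof (rule norm_dual_le)
    show "0 \<le> norm f * onorm T" using onorm_pos_le[OF T] by simp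
    fix x
    have "\<bar>dual_apply f (T x)\<bar> \<le> norm f * norm (T x)" by (rule abs_dual_apply_le)
    also have "\<dots> \<le> norm f * (onorm T * norm x)"
      by (intro mult_left_mono onorm[OF T]) simp
    finally show "\<bar>dual_apply (dual_adjoint T f) x\<bar> \<le> norm f * onorm T * norm x"
      by (simp add: dual_adjoint_apply[OF T] mult.assoc)
  qed
qed

lemma weakly_null_bounded_linear:
  assumes S: "bounded_linear S" and x: "weakly_null x"
  shows "weakly_null (\<lambda>n. S (x n))"
  unfolding weakly_null_def
proof
  fix \<phi>
  have "bounded_linear (\<lambda>y. dual_apply \<phi> (S y))"
    by (rule bounded_linear_compose[OF bounded_linear_dual_apply S])
  then have "dual_apply (Dual (\<lambda>y. dual_apply \<phi> (S y))) (x n) = dual_apply \<phi> (S (x n))" for n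
    by (simp add: Dual_inverse)
  then show "(\<lambda>n. dual_apply \<phi> (S (x n))) \<longlonglongrightarrow> 0"
    using x[unfolded weakly_null_def, rule_format, of "Dual (\<lambda>y. dual_apply \<phi> (S y))"] by simp
qed

text \<open>The positive Schur property does not apply to \<open>P\<^sup>* f\<^sub>n\<close>, which need not be positive; it
  applies to the dominating sequence \<open>P\<^sup>* \<bar>f\<^sub>n\<bar>\<close>.\<close>

lemma positive_adjoint_tendsto_zero:
  fixes P :: "'e::banach_lattice \<Rightarrow> 'f::banach_lattice" and f :: "nat \<Rightarrow> 'f dual"
  assumes schur: "positive_schur TYPE('e dual)" and P: "positive_operator P"
    and disj: "disjoint_sequence f" and null: "weakly_null f"
  shows "(\<lambda>n. dual_adjoint P (f n)) \<longlonglongrightarrow> 0"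
proof -
  note bl = positive_operator_bounded[OF P]
  interpret adj: bounded_linear "dual_adjoint P" by (rule bounded_linear_dual_adjoint[OF bl])
  have mono: "dual_adjoint P g \<le> dual_adjoint P h" if "g \<le> h" for g h
    using that P by (simp add: less_eq_dual_def dual_adjoint_apply[OF bl] positive_operator_def)
  have nonneg: "0 \<le> dual_adjoint P \<bar>f n\<bar>" for n
    using mono[of 0 "\<bar>f n\<bar>"] by (simp add: adj.zero)
  have le: "norm (dual_adjoint P (f n)) \<le> norm (dual_adjoint P \<bar>f n\<bar>)" for n
  proof (rule norm_le_if_abs_le)
    have "dual_adjoint P (f n) \<le> dual_adjoint P \<bar>f n\<bar>"
      by (intro mono) (simp add: abs_lattice)
    moreover have "- dual_adjoint P (f n) \<le> dual_adjoint P \<bar>f n\<bar>"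
      using mono[of "- f n" "\<bar>f n\<bar>"] by (simp add: adj.neg abs_lattice)
    ultimately show "\<bar>dual_adjoint P (f n)\<bar> \<le> \<bar>dual_adjoint P \<bar>f n\<bar>\<bar>"
      using nonneg[of n] by (auto intro: abs_leI)
  qed
  have "(\<lambda>n. dual_adjoint P \<bar>f n\<bar>) \<longlonglongrightarrow> 0"
    using schur nonneg
      weakly_null_bounded_linear[OF adj.bounded_linear_axioms weakly_null_abs[OF disj null]]
    by (simp add: positive_schur_def)
  then show ?thesis
    by (rule Lim_null_comparison[OF always_eventually, rotated, OF tendsto_norm_zero])
       (simp add: le)
qed

theorem proposition4p2:
  fixes T :: "'e::banach_lattice \<Rightarrow> 'f::banach_lattice"
  assumes "positive_schur TYPE('e dual)"
    and "regular_operator T"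
  shows "almost_dunford_pettis (dual_adjoint T :: 'f dual \<Rightarrow> 'e dual)"
proof -
  note T = regular_operator_bounded[OF assms(2)]
  obtain P Q where PQ: "positive_operator P" "positive_operator Q" "T = (\<lambda>x. P x - Q x)"
    using assms(2) by (auto simp: regular_operator_def)
  have diff: "dual_adjoint T f = dual_adjoint P f - dual_adjoint Q f" for f
    by (rule dual_eqI)
      (simp add: dual_adjoint_apply T PQ(1,2)[THEN positive_operator_bounded], simp add: PQ(3))
  have "(\<lambda>n. dual_adjoint T (f n)) \<longlonglongrightarrow> 0" if "disjoint_sequence f" "weakly_null f" for f
    using tendsto_diff[OF positive_adjoint_tendsto_zero[OF assms(1) PQ(1) that]
        positive_adjoint_tendsto_zero[OF assms(1) PQ(2) that]]
    by (simp add: diff)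
  then show ?thesis
    unfolding almost_dunford_pettis_def
    using bounded_linear.linear[OF bounded_linear_dual_adjoint[OF T]] by blast
qed

end
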